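(* Let $m\ge3$ and let $(r_i(g))_{i\ge1}$, $(q_i(g))_{i\ge1}$ be the formal power series in $g$ uniquely determined by $$r_i(g)=i+\sum_{a=0}^{m-2}q_{i-a}(g),\qquad q_i(g)=g\prod_{a=0}^{m-2}r_{i+a}(g),\qquad i\ge1,$$ with the convention $q_i(g)=0$ for $i\le 0$. Then, for all $i\ge1$, $$m\,g\frac{d}{dg}\log r_i(g)=q_{i+1}(g)-q_{i-m+1}(g).$$
   Context: Here $\frac{d}{dg}\log r_i(g)$ means $r_i'(g)/r_i(g)$ (note $r_i(0)=i\neq0$). *)

theory Defs
  imports "HOL-Computational_Algebra.Formal_Power_Series"
begin

text \<open>
  Sequences are indexed by \<^typ>\<open>int\<close>, so that \<open>q (i - a)\<close> is an honest shift and the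
  convention \<open>q i = 0\<close> for \<open>i \<le> 0\<close> is an equation. The values \<open>r i\<close> for \<open>i \<le> 0\<close> are
  unconstrained and never referred to. \<^const>\<open>fps_X\<close> is the formal variable \<open>g\<close>.
\<close>

definition rq_system ::
    "nat \<Rightarrow> (int \<Rightarrow> 'a::field_char_0 fps) \<Rightarrow> (int \<Rightarrow> 'a fps) \<Rightarrow> bool" where
  "rq_system m r q \<longleftrightarrow>
     (\<forall>i\<ge>1. r i = of_int i + (\<Sum>a=0..m-2. q (i - int a))) \<and>
     (\<forall>i\<ge>1. q i = fps_X * (\<Prod>a=0..m-2. r (i + int a))) \<and>
     (\<forall>i\<le>0. q i = 0)"

definition fps_dlog :: "'a::field_char_0 fps \<Rightarrow> 'a fps" where
  "fps_dlog f = fps_deriv f / f"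

end

theory Submission
  imports Defs
begin

text \<open>
  Existence and uniqueness hold because the system is a fixed-point equation whose right-hand side
  gains a factor \<open>g\<close>. For the identity, put \<open>p = m - 2\<close>. Taking logarithmic derivatives of the
  second equation shows that \<open>u i = g * r' i / r i\<close> solves
  \<open>r i * u i = (\<Sum>a=0..p. q (i - a) * (1 + (\<Sum>b=0..p. u (i - a + b))))\<close>,
  again a contractive equation, so it has only one solution. That
  \<open>v i = (q (i + 1) - q (i - p - 1)) / m\<close> solves it as well follows because the \<open>a\<close>-th summand becomes
  \<open>q j * (r (j + p + 1) - r (j - 1)) / m\<close> with \<open>j = i - a\<close>, and
  \<open>q j * r (j - 1) = q (j - 1) * r (j + p)\<close> makes the sum telescope.
\<close>

unbundle fps_syntax

section \<open>Congruences modulo powers of \<open>fps_X\<close> and contractive maps on families of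
  power series\<close>

lemma fps_X_power_dvd_iff:
  fixes f :: "'a::comm_ring_1 fps"
  shows "fps_X ^ n dvd f \<longleftrightarrow> (\<forall>k<n. f $ k = 0)"
proof
  assume "fps_X ^ n dvd f"
  then show "\<forall>k<n. f $ k = 0"
    by (auto elim!: dvdE simp: fps_X_power_mult_nth)
next
  assume *: "\<forall>k<n. f $ k = 0"
  have "f = fps_X ^ n * fps_shift n f"
    using * by (auto simp: fps_eq_iff fps_X_power_mult_nth)
  then show "fps_X ^ n dvd f"
    by (metis dvd_triv_left)
qed

lemma dvd_diff_prod:
  fixes f g :: "'b \<Rightarrow> 'a::comm_ring_1"
  assumes "\<And>x. x \<in> A \<Longrightarrow> d dvd f x - g x"
  shows "d dvd prod f A - prod g A"
  using assms
proof (induction A rule: infinite_finite_induct)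
  case (insert x A)
  have "prod f (insert x A) - prod g (insert x A)
      = f x * (prod f A - prod g A) + (f x - g x) * prod g A"
    using insert.hyps by (simp add: algebra_simps)
  then show ?case
    using insert by auto
qed auto

lemma dvd_diff_sum:
  fixes f g :: "'b \<Rightarrow> 'a::comm_ring_1"
  assumes "\<And>x. x \<in> A \<Longrightarrow> d dvd f x - g x"
  shows "d dvd sum f A - sum g A"
  using assms by (simp add: dvd_sum flip: sum_subtractf)

text \<open>This is strict contractivity for the \<open>fps_X\<close>-adic metric, taken uniformly
  over the index, so that \<open>T f i\<close> may depend on \<open>f\<close> at any other
  index.\<close>

definition fps_contraction :: "(('i \<Rightarrow> 'a::comm_ring_1 fps) \<Rightarrow> 'i \<Rightarrow> 'a fps) \<Rightarrow> bool" where
  "fps_contraction T \<longleftrightarrow>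
     (\<forall>n f g. (\<forall>i. fps_X ^ n dvd f i - g i) \<longrightarrow> (\<forall>i. fps_X ^ Suc n dvd T f i - T g i))"

lemma fps_contractionD:
  assumes "fps_contraction T" and "\<And>i. fps_X ^ n dvd f i - g i"
  shows "fps_X ^ Suc n dvd T f i - T g i"
  using assms unfolding fps_contraction_def by blast

text \<open>All families agree modulo \<open>fps_X ^ 0\<close>, and each application of
  \<open>T\<close> gains one power, so two fixed points agree modulo every power.\<close>

lemma fps_contraction_unique:
  assumes T: "fps_contraction T" and f: "T f = f" and g: "T g = g"
  shows "f = g"
proof -
  have dvd: "fps_X ^ n dvd f i - g i" for n i
  proof (induction n arbitrary: i)
    case (Suc n)
    then show ?case
      using fps_contractionD[OF T, of n f g i] f g by simp
  qed simp
  have "f i $ n = g i $ n" for i n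
    using dvd[of "Suc n" i] unfolding fps_X_power_dvd_iff by simp
  then show ?thesis
    by (auto simp: fps_eq_iff)
qed

lemma fps_contraction_fixpoint:
  fixes T :: "('i \<Rightarrow> 'a::comm_ring_1 fps) \<Rightarrow> 'i \<Rightarrow> 'a fps"
  assumes T: "fps_contraction T"
  obtains f where "T f = f"
proof -
  define R where "R n = (T ^^ n) (\<lambda>_. 0)" for n
  \<comment> \<open>\<open>R n\<close> and \<open>R (Suc n)\<close> agree only below degree
    \<open>n\<close>, so the coefficient at \<open>n\<close> is guaranteed to be final from
    \<open>R (Suc n)\<close> on.\<close>
  define f where "f i = Abs_fps (\<lambda>n. R (Suc n) i $ n)" for i
  have R_Suc: "R (Suc n) = T (R n)" for n
    by (simp add: R_def)
  have step: "fps_X ^ n dvd R (Suc n) i - R n i" for n i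
  proof (induction n arbitrary: i)
    case (Suc n)
    then show ?case
      unfolding R_Suc[of "Suc n"] R_Suc[of n] by (intro fps_contractionD[OF T]) (simp add: R_Suc)
  qed simp
  have stable: "R (k + d) i $ n = R k i $ n" if "n < k" for n k d i
  proof (induction d)
    case (Suc d)
    then show ?case
      using step[of "k + d" i] that by (simp add: fps_X_power_dvd_iff)
  qed simp
  have approx: "fps_X ^ n dvd f i - R n i" for n i
    unfolding fps_X_power_dvd_iff
  proof (intro allI impI)
    fix k assume "k < n"
    then show "(f i - R n i) $ k = 0"
      using stable[of k "Suc k" "n - Suc k" i] by (simp add: f_def)
  qed
  have "T f i $ n = f i $ n" for i n
  proof -
    have "fps_X ^ Suc n dvd T f i - R (Suc n) i"
      unfolding R_Suc by (rule fps_contractionD[OF T approx])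
    then show ?thesis
      unfolding fps_X_power_dvd_iff by (simp add: f_def)
  qed
  then have "T f = f"
    by (auto simp: fps_eq_iff)
  then show ?thesis
    by (rule that)
qed

section \<open>The system as a fixed-point equation for \<open>r\<close> alone\<close>

definition rq_q :: "nat \<Rightarrow> (int \<Rightarrow> 'a::field_char_0 fps) \<Rightarrow> int \<Rightarrow> 'a fps" where
  "rq_q p r j = (if j \<le> 0 then 0 else fps_X * (\<Prod>a=0..p. r (j + int a)))"

text \<open>Substituting the second equation into the first eliminates \<open>q\<close>. The
  fixed-point equation is imposed at every integer, which forces \<open>r i = of_int i\<close> for
  \<open>i \<le> 0\<close>.\<close>

definition rq_map :: "nat \<Rightarrow> (int \<Rightarrow> 'a::field_char_0 fps) \<Rightarrow> int \<Rightarrow> 'a fps" where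
  "rq_map p r i = of_int i + (\<Sum>a=0..p. rq_q p r (i - int a))"

lemma fps_contraction_rq_map: "fps_contraction (rq_map p)"
  unfolding fps_contraction_def
proof (intro allI impI)
  fix n i and f g :: "int \<Rightarrow> 'a fps"
  assume *: "\<forall>i. fps_X ^ n dvd f i - g i"
  have "fps_X ^ Suc n dvd rq_q p f j - rq_q p g j" for j
  proof (cases "j \<le> 0")
    case False
    have "rq_q p f j - rq_q p g j
        = fps_X * ((\<Prod>a=0..p. f (j + int a)) - (\<Prod>a=0..p. g (j + int a)))"
      using False by (simp add: rq_q_def right_diff_distrib)
    moreover have "fps_X ^ n dvd (\<Prod>a=0..p. f (j + int a)) - (\<Prod>a=0..p. g (j + int a))"
      using * by (intro dvd_diff_prod) auto
    ultimately show ?thesis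
      by (simp add: mult_dvd_mono)
  qed (simp add: rq_q_def)
  then have "fps_X ^ Suc n dvd (\<Sum>a=0..p. rq_q p f (i - int a)) - (\<Sum>a=0..p. rq_q p g (i - int a))"
    by (intro dvd_diff_sum)
  then show "fps_X ^ Suc n dvd rq_map p f i - rq_map p g i"
    by (simp add: rq_map_def)
qed

lemma rq_system_of_fixpoint:
  assumes "rq_map (m - 2) r = r"
  shows "rq_system m r (rq_q (m - 2) r)"
  unfolding rq_system_def
proof (intro conjI allI impI)
  fix i :: int
  show "r i = of_int i + (\<Sum>a=0..m-2. rq_q (m - 2) r (i - int a))"
    using fun_cong[OF assms, of i] by (simp add: rq_map_def)
qed (simp_all add: rq_q_def)

text \<open>Setting \<open>r i = i\<close> for \<open>i \<le> 0\<close> makes the first equation hold at every index.\<close>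

lemma rq_system_extend:
  assumes "rq_system m r q"
  defines "r' \<equiv> (\<lambda>i. if i \<ge> 1 then r i else of_int i)"
  shows "q = rq_q (m - 2) r'" and "rq_map (m - 2) r' = r'"
proof -
  have *: "(\<forall>i\<ge>1. r i = of_int i + (\<Sum>a=0..m-2. q (i - int a)))"
    "(\<forall>i\<ge>1. q i = fps_X * (\<Prod>a=0..m-2. r (i + int a)))" "(\<forall>i\<le>0. q i = 0)"
    using assms(1) by (auto simp: rq_system_def)
  show q: "q = rq_q (m - 2) r'"
  proof
    fix j show "q j = rq_q (m - 2) r' j"
      using * by (auto simp: rq_q_def r'_def intro!: prod.cong)
  qed
  show "rq_map (m - 2) r' = r'"
  proof
    fix i
    have "(\<Sum>a=0..m-2. q (i - int a)) = 0" if "i \<le> 0"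
      using * that by (intro sum.neutral) auto
    moreover have "rq_map (m - 2) r' i = of_int i + (\<Sum>a=0..m-2. q (i - int a))"
      unfolding rq_map_def q[symmetric] ..
    ultimately show "rq_map (m - 2) r' i = r' i"
      using *(1) by (auto simp: r'_def)
  qed
qed

section \<open>Logarithmic derivatives of the solution\<close>

lemma of_nat_mult_fps_const_inverse:
  assumes "n \<noteq> 0"
  shows "of_nat n * fps_const (1 / of_nat n) = (1 :: 'a::field_char_0 fps)"
  using assms by (simp flip: fps_of_nat)

text \<open>The product rule for logarithmic derivatives in division-free form: \<open>u x\<close>
  stands for \<open>h\<close> times the logarithmic derivative of \<open>f x\<close>.\<close>

lemma fps_deriv_prod_dlog:
  fixes f u :: "'b \<Rightarrow> 'a::comm_ring_1 fps"
  assumes "finite A" and "\<And>x. x \<in> A \<Longrightarrow> h * fps_deriv (f x) = f x * u x"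
  shows "h * fps_deriv (prod f A) = prod f A * sum u A"
  using assms
proof (induction A rule: finite_induct)
  case (insert x A)
  then have IH: "h * fps_deriv (prod f A) = prod f A * sum u A" "h * fps_deriv (f x) = f x * u x"
    by auto
  have "h * fps_deriv (prod f (insert x A))
      = f x * (h * fps_deriv (prod f A)) + (h * fps_deriv (f x)) * prod f A"
    using insert.hyps by (simp add: algebra_simps)
  also have "\<dots> = prod f (insert x A) * sum u (insert x A)"
    unfolding IH using insert.hyps by (simp add: algebra_simps)
  finally show ?case .
qed auto

text \<open>The equation for \<open>r\<close> is assumed at all integers, as holds after the
  extension to \<open>i \<le> 0\<close>; shifted indices then need no bounds, and
  \<open>r 0 = 0\<close>.\<close>

locale rq_fixpoint =
  fixes p :: nat and r q :: "int \<Rightarrow> 'a::field_char_0 fps"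
  assumes r_eq: "r i = of_int i + (\<Sum>a=0..p. q (i - int a))"
    and q_pos: "j \<ge> 1 \<Longrightarrow> q j = fps_X * (\<Prod>a=0..p. r (j + int a))"
    and q_nonpos: "j \<le> 0 \<Longrightarrow> q j = 0"
begin

lemma fps_X_dvd_q: "fps_X dvd q j"
  using q_pos[of j] q_nonpos[of j] by (cases "j \<ge> 1") auto

lemma r_nth_0: "r i $ 0 = of_int i"
proof -
  have "q j $ 0 = 0" for j
    using fps_X_dvd_q[of j] by auto
  then show ?thesis
    by (subst r_eq) (simp add: fps_sum_nth)
qed

text \<open>For \<open>j \<ge> 2\<close> both sides are \<open>fps_X\<close> times the product of
  \<open>r (j - 1)\<close> up to \<open>r (j + int p)\<close>, with one repeated-free range split at
  either end. At the boundary \<open>j = 1\<close> both sides vanish because \<open>r 0 = 0\<close>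
  and \<open>q 0 = 0\<close>.\<close>

lemma q_shift: "q j * r (j - 1) = q (j - 1) * r (j + int p)"
proof -
  consider "j \<le> 0" | "j = 1" | "j \<ge> 2" by linarith
  then show ?thesis
  proof cases
    case 2
    have "r 0 = 0"
      using q_nonpos by (subst r_eq) (simp add: sum.neutral)
    with 2 show ?thesis
      by (simp add: q_nonpos)
  next
    case 3
    have "(\<Prod>a=0..p. r (j + int a)) * r (j - 1) = (\<Prod>a=0..Suc p. r (j - 1 + int a))"
      by (subst prod.atLeast0_atMost_Suc_shift) (simp add: algebra_simps)
    also have "\<dots> = (\<Prod>a=0..p. r (j - 1 + int a)) * r (j + int p)"
      by simp
    finally show ?thesis
      using 3 by (simp add: q_pos mult.assoc)
  qed (simp add: q_nonpos)
qed

lemma sum_q_eq: "(\<Sum>b=0..p. q (j + int b)) = r (j + int p) - of_int (j + int p)"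
proof -
  have "(\<Sum>b=0..p. q (j + int b)) = (\<Sum>a=0..p. q (j + int p - int a))"
    by (rule sum.reindex_bij_witness[of _ "\<lambda>a. p - a" "\<lambda>a. p - a"]) (auto simp: of_nat_diff)
  then show ?thesis
    using r_eq[of "j + int p"] by simp
qed

text \<open>Nonpositive indices are set to 0 because \<open>r i\<close> is a unit only for
  \<open>i \<noteq> 0\<close>, and so that a fixed point is determined at every index.\<close>

definition dlog_map :: "(int \<Rightarrow> 'a fps) \<Rightarrow> int \<Rightarrow> 'a fps" where
  "dlog_map u i = (if i \<ge> 1
     then inverse (r i) * (\<Sum>a=0..p. q (i - int a) * (1 + (\<Sum>b=0..p. u (i - int a + int b))))
     else 0)"

lemma fps_contraction_dlog_map: "fps_contraction dlog_map"
  unfolding fps_contraction_def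
proof (intro allI impI)
  fix n i and f g :: "int \<Rightarrow> 'a fps"
  assume *: "\<forall>i. fps_X ^ n dvd f i - g i"
  let ?s = "\<lambda>f j. 1 + (\<Sum>b=0..p. f (j + int b))"
  have "fps_X ^ Suc n dvd q j * ?s f j - q j * ?s g j" for j
  proof -
    have "fps_X ^ n dvd (\<Sum>b=0..p. f (j + int b)) - (\<Sum>b=0..p. g (j + int b))"
      using * by (intro dvd_diff_sum) auto
    then have "fps_X * fps_X ^ n dvd q j * (?s f j - ?s g j)"
      by (intro mult_dvd_mono fps_X_dvd_q) simp
    then show ?thesis
      by (simp only: right_diff_distrib power_Suc)
  qed
  then have "fps_X ^ Suc n dvd (\<Sum>a=0..p. q (i - int a) * ?s f (i - int a))
      - (\<Sum>a=0..p. q (i - int a) * ?s g (i - int a))"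
    by (intro dvd_diff_sum)
  then show "fps_X ^ Suc n dvd dlog_map f i - dlog_map g i"
    by (simp add: dlog_map_def dvd_mult flip: right_diff_distrib)
qed

lemma dlog_map_fixpointI:
  assumes eq: "\<And>i. i \<ge> 1 \<Longrightarrow>
      r i * u i = (\<Sum>a=0..p. q (i - int a) * (1 + (\<Sum>b=0..p. u (i - int a + int b))))"
  defines "u' \<equiv> (\<lambda>i. if i \<ge> 1 then u i else 0)"
  shows "dlog_map u' = u'"
proof
  fix i
  show "dlog_map u' i = u' i"
  proof (cases "i \<ge> 1")
    case True
    have "(\<Sum>a=0..p. q (i - int a) * (1 + (\<Sum>b=0..p. u' (i - int a + int b))))
        = (\<Sum>a=0..p. q (i - int a) * (1 + (\<Sum>b=0..p. u (i - int a + int b))))"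
    proof (intro sum.cong refl)
      fix a
      show "q (i - int a) * (1 + (\<Sum>b=0..p. u' (i - int a + int b)))
          = q (i - int a) * (1 + (\<Sum>b=0..p. u (i - int a + int b)))"
        \<comment> \<open>If \<open>i - int a \<ge> 1\<close>, all inner indices are positive, where
          \<open>u\<close> and \<open>u'\<close> agree; otherwise the factor
          \<open>q (i - int a)\<close> is 0.\<close>
        by (cases "i - int a \<ge> 1") (simp_all add: u'_def q_nonpos)
    qed
    also have "\<dots> = r i * u i"
      using eq True by simp
    finally have "dlog_map u' i = inverse (r i) * r i * u i"
      using True by (simp add: dlog_map_def mult.assoc)
    also have "inverse (r i) * r i = 1"
      using True by (intro inverse_mult_eq_1) (simp add: r_nth_0)
    finally show ?thesis
      using True by (simp add: u'_def)
  qed (simp add: dlog_map_def u'_def)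
qed

lemma dlog_unique:
  assumes "\<And>i. i \<ge> 1 \<Longrightarrow>
      r i * u i = (\<Sum>a=0..p. q (i - int a) * (1 + (\<Sum>b=0..p. u (i - int a + int b))))"
    and "\<And>i. i \<ge> 1 \<Longrightarrow>
      r i * v i = (\<Sum>a=0..p. q (i - int a) * (1 + (\<Sum>b=0..p. v (i - int a + int b))))"
    and "i \<ge> 1"
  shows "u i = v i"
proof -
  have "(\<lambda>i. if i \<ge> 1 then u i else 0) = (\<lambda>i. if i \<ge> 1 then v i else 0)"
    by (rule fps_contraction_unique[OF fps_contraction_dlog_map]; rule dlog_map_fixpointI)
      (erule assms(1) assms(2))+
  from fun_cong[OF this, of i] show ?thesis
    by (simp only: assms(3) if_True)
qed

text \<open>The constant term \<open>i\<close> of \<open>r i\<close> is nonzero in characteristic 0,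
  so the division in \<open>fps_dlog\<close> is exact.\<close>

lemma r_mult_dlog:
  assumes "i \<ge> 1"
  shows "r i * (fps_X * fps_dlog (r i)) = fps_X * fps_deriv (r i)"
proof -
  have "r i dvd fps_deriv (r i)"
    using assms by (intro fps_unit_dvd) (simp add: r_nth_0)
  then show ?thesis
    by (simp add: fps_dlog_def mult.left_commute)
qed

lemma dlog_equation:
  assumes "i \<ge> 1"
  defines "u \<equiv> (\<lambda>i. fps_X * fps_dlog (r i))"
  shows "r i * u i = (\<Sum>a=0..p. q (i - int a) * (1 + (\<Sum>b=0..p. u (i - int a + int b))))"
proof -
  \<comment> \<open>The summand 1 comes from differentiating the factor \<open>fps_X\<close> of
    \<open>q j\<close>, the inner sum from the product of the \<open>r (j + int b)\<close>.\<close>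
  have q': "fps_X * fps_deriv (q j) = q j * (1 + (\<Sum>b=0..p. u (j + int b)))" for j
  proof (cases "j \<ge> 1")
    case True
    let ?P = "\<Prod>a=0..p. r (j + int a)"
    have "fps_X * fps_deriv ?P = ?P * (\<Sum>b=0..p. u (j + int b))"
      using True by (intro fps_deriv_prod_dlog) (auto simp: u_def r_mult_dlog)
    then show ?thesis
      unfolding q_pos[OF True] by (simp add: algebra_simps)
  qed (simp add: q_nonpos)
  have "fps_deriv (r i) = (\<Sum>a=0..p. fps_deriv (q (i - int a)))"
    by (subst r_eq) (simp add: fps_deriv_sum)
  then have "r i * u i = (\<Sum>a=0..p. fps_X * fps_deriv (q (i - int a)))"
    using assms by (simp add: u_def r_mult_dlog sum_distrib_left)
  then show ?thesis
    by (simp add: q')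
qed

lemma q_difference_equation:
  defines "c \<equiv> fps_const (1 / of_nat (p + 2)) :: 'a fps"
  defines "v \<equiv> (\<lambda>i. c * (q (i + 1) - q (i - int p - 1)))"
  shows "r i * v i = (\<Sum>a=0..p. q (i - int a) * (1 + (\<Sum>b=0..p. v (i - int a + int b))))"
proof -
  \<comment> \<open>With \<open>j = i - int a\<close>, \<open>q_shift\<close> turns
    \<open>F (Suc a)\<close> into \<open>q j * r (j - 1)\<close>, which gives the
    telescoping.\<close>
  define F where "F a = q (i - int a) * r (i - int a + int p + 1)" for a
  have c: "c * of_nat (p + 2) = 1"
    using of_nat_mult_fps_const_inverse[of "p + 2"] by (simp only: c_def mult.commute) simp
  have summand: "q (i - int a) * (1 + (\<Sum>b=0..p. v (i - int a + int b))) = c * (F a - F (Suc a))"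
    for a
  proof -
    define j where "j = i - int a"
    have "(\<Sum>b=0..p. v (j + int b))
        = c * ((\<Sum>b=0..p. q (j + 1 + int b)) - (\<Sum>b=0..p. q (j - int p - 1 + int b)))"
      by (simp add: v_def sum_distrib_left sum_subtractf right_diff_distrib algebra_simps)
    \<comment> \<open>The integer parts supplied by \<open>sum_q_eq\<close> at \<open>j + 1\<close>
      and \<open>j - int p - 1\<close> differ by \<open>p + 2\<close>; multiplied by
      \<open>c\<close> this is 1 and cancels the leading 1. This fixes the constant
      \<open>c\<close>.\<close>
    also have "\<dots> = c * (r (j + int p + 1) - r (j - 1) - of_nat (p + 2))"
      unfolding sum_q_eq by (simp add: algebra_simps)
    finally have v: "1 + (\<Sum>b=0..p. v (j + int b)) = c * (r (j + int p + 1) - r (j - 1))"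
      using c by (simp add: right_diff_distrib)
    have "q j * (1 + (\<Sum>b=0..p. v (j + int b)))
        = c * (q j * r (j + int p + 1) - q j * r (j - 1))"
      unfolding v by (simp add: algebra_simps)
    also have "\<dots> = c * (F a - F (Suc a))"
      unfolding q_shift by (simp add: F_def j_def algebra_simps)
    finally show ?thesis
      by (simp add: j_def)
  qed
  have "(\<Sum>a=0..p. F a - F (Suc a)) = F 0 - F (Suc p)"
    using sum_telescope[of F p] by (simp add: atMost_atLeast0)
  \<comment> \<open>\<open>F 0\<close> equals \<open>q (i + 1) * r i\<close> by
    \<open>q_shift\<close> at \<open>i + 1\<close>, while \<open>F (Suc p)\<close> already contains
    the factor \<open>r i\<close>.\<close>
  also have "\<dots> = r i * (q (i + 1) - q (i - int p - 1))"
    using q_shift[of "i + 1"] by (simp add: F_def algebra_simps)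
  finally have "c * (\<Sum>a=0..p. F a - F (Suc a)) = r i * v i"
    by (simp add: v_def mult.left_commute)
  then show ?thesis
    by (simp only: summand sum_distrib_left)
qed

lemma dlog_eq:
  assumes "i \<ge> 1"
  shows "of_nat (p + 2) * (fps_X * fps_dlog (r i)) = q (i + 1) - q (i - int p - 1)"
proof -
  let ?c = "fps_const (1 / of_nat (p + 2)) :: 'a fps"
  have "fps_X * fps_dlog (r i) = ?c * (q (i + 1) - q (i - int p - 1))"
    by (rule dlog_unique[OF dlog_equation q_difference_equation assms])
  moreover have "of_nat (p + 2) * ?c = 1"
    by (rule of_nat_mult_fps_const_inverse) simp
  ultimately show ?thesis
    by (simp only: mult.assoc[symmetric] mult_1_left)
qed

end

theorem mainTheorem5:
  fixes m :: nat
  assumes "m \<ge> 3"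
  shows "(\<exists>(r :: int \<Rightarrow> 'a::field_char_0 fps) q. rq_system m r q) \<and>
    (\<forall>(r :: int \<Rightarrow> 'a fps) q r' q'. rq_system m r q \<and> rq_system m r' q' \<longrightarrow>
       (\<forall>i\<ge>1. r i = r' i \<and> q i = q' i)) \<and>
    (\<forall>(r :: int \<Rightarrow> 'a fps) q. rq_system m r q \<longrightarrow>
       (\<forall>i\<ge>1. of_nat m * fps_X * fps_dlog (r i) = q (i + 1) - q (i - int m + 1)))"
proof (intro conjI allI impI)
  obtain r :: "int \<Rightarrow> 'a fps" where "rq_map (m - 2) r = r"
    using fps_contraction_fixpoint[OF fps_contraction_rq_map] by blast
  then show "\<exists>(r :: int \<Rightarrow> 'a fps) q. rq_system m r q"
    using rq_system_of_fixpoint by blast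
next
  fix r q r' q' :: "int \<Rightarrow> 'a fps" and i :: int
  assume sys: "rq_system m r q \<and> rq_system m r' q'" and i: "i \<ge> 1"
  \<comment> \<open>The system says nothing about \<open>r\<close> at nonpositive indices, so the
    two solutions are compared after normalising them there.\<close>
  have eq: "(\<lambda>i. if i \<ge> 1 then r i else of_int i) = (\<lambda>i. if i \<ge> 1 then r' i else of_int i)"
    by (rule fps_contraction_unique[OF fps_contraction_rq_map[of "m - 2"]];
        rule rq_system_extend(2)) (use sys in blast)+
  show "r i = r' i"
    using fun_cong[OF eq, of i] i by simp
  show "q i = q' i"
    using rq_system_extend(1)[of m r q] rq_system_extend(1)[of m r' q'] sys
    unfolding eq by metis
next
  fix r q :: "int \<Rightarrow> 'a fps" and i :: int
  assume sys: "rq_system m r q" and i: "i \<ge> 1"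
  define s where "s = (\<lambda>i. if i \<ge> 1 then r i else of_int i)"
  have q: "q = rq_q (m - 2) s" and s: "rq_map (m - 2) s = s"
    unfolding s_def by (fact rq_system_extend[OF sys])+
  interpret rq_fixpoint "m - 2" s q
  proof
    show "s i = of_int i + (\<Sum>a=0..m-2. q (i - int a))" for i
      using fun_cong[OF s, of i] unfolding rq_map_def q[symmetric] by simp
    show "q j = fps_X * (\<Prod>a=0..m-2. s (j + int a))" if "j \<ge> 1" for j
      using that by (subst q) (simp add: rq_q_def)
    show "q j = 0" if "j \<le> 0" for j
      using that by (subst q) (simp add: rq_q_def)
  qed
  \<comment> \<open>Since \<open>m \<ge> 3\<close>, the natural subtraction \<open>m - 2\<close> is
    exact, so \<open>p + 2\<close> is \<open>m\<close> and \<open>i - int p - 1\<close> is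
    \<open>i - int m + 1\<close>.\<close>
  have "of_nat m * (fps_X * fps_dlog (s i)) = q (i + 1) - q (i - int m + 1)"
    using dlog_eq[OF i] assms by (simp add: algebra_simps)
  then show "of_nat m * fps_X * fps_dlog (r i) = q (i + 1) - q (i - int m + 1)"
    using i by (simp add: s_def mult.assoc)
qed

end
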